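(* Let $n,m\ge 1$ and let $F:D^n\to\mathbb{R}^m$ be a continuous map such that $F(x)\neq 0$ for every $x\in S^{n-1}$. Let $F_\mid:S^{n-1}\to\mathbb{R}^m\setminus\{0\}$, $F_\mid(x)=F(x)$, be the restriction. Then the following are equivalent: (i) every extension $\varphi:D^n\to\mathbb{R}^m$ of $F_\mid$ has a zero, i.e. there exists $x\in D^n$ with $\varphi(x)=0$; (ii) $\mathrm{cat}(F_\mid)=2$.
   Context: $D^n\subset\mathbb{R}^n$ is the closed unit disk and $S^{n-1}=\partial D^n$ the unit sphere. An extension of $F_\mid$ to $D^n$ is a continuous map $\varphi:D^n\to\mathbb{R}^m$ with $\varphi(x)=F_\mid(x)$ for all $x\in S^{n-1}$. A continuous map $f:X\to Y$ of topological spaces is null-homotopic if it is homotopic to a constant map $X\to Y$, $x\mapsto y_0$, for some $y_0\in Y$ (homotopies are free, without base points). The category $\mathrm{cat}(f)$ of a continuous map $f:X\to Y$ is the least positive integer $k$ such that there are open subsets $U_1,\dots,U_k$ of $X$ with $X=U_1\cup\cdots\cup U_k$ and each restriction $f_{|U_i}:U_i\to Y$ null-homotopic; $\mathrm{cat}(f)=\infty$ if no such integer exists. *)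

theory Defs
  imports "HOL-Analysis.Analysis" "HOL-Library.Extended_Nat"
begin

text \<open>
  The base value is required to lie in the target space: for an empty domain,
  \<open>homotopic_with\<close> alone would not force this.
\<close>
definition null_homotopic :: "'a topology \<Rightarrow> 'b topology \<Rightarrow> ('a \<Rightarrow> 'b) \<Rightarrow> bool" where
  "null_homotopic X Y f \<longleftrightarrow>
     (\<exists>y0\<in>topspace Y. homotopic_with (\<lambda>_. True) X Y f (\<lambda>_. y0))"

definition categorical_cover ::
  "'a topology \<Rightarrow> 'b topology \<Rightarrow> ('a \<Rightarrow> 'b) \<Rightarrow> nat \<Rightarrow> (nat \<Rightarrow> 'a set) \<Rightarrow> bool" where
  "categorical_cover X Y f k U \<longleftrightarrow>
     (\<forall>i\<in>{1..k}. openin X (U i) \<and> null_homotopic (subtopology X (U i)) Y f) \<and>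
     topspace X = (\<Union>i\<in>{1..k}. U i)"

text \<open>The infimum of the empty set in \<open>enat\<close> is \<open>\<infinity>\<close>.\<close>
definition map_cat :: "'a topology \<Rightarrow> 'b topology \<Rightarrow> ('a \<Rightarrow> 'b) \<Rightarrow> enat" where
  "map_cat X Y f = Inf {enat k |k. k \<ge> 1 \<and> (\<exists>U. categorical_cover X Y f k U)}"

definition is_extension ::
  "(real ^ 'n \<Rightarrow> real ^ 'm) \<Rightarrow> (real ^ 'n \<Rightarrow> real ^ 'm) \<Rightarrow> bool" where
  "is_extension g \<phi> \<longleftrightarrow>
     continuous_on (cball 0 1) \<phi> \<and> (\<forall>x\<in>sphere 0 1. \<phi> x = g x)"

end

theory Submission
  imports Defs
begin

text \<open>
  The complements of two antipodal points are contractible and cover the sphere, so the category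
  of any map out of a sphere is at most 2. Hence it differs from 2 exactly when it is at most 1,
  i.e. when the map is null-homotopic; for a sphere this means that the map extends over the ball
  without leaving the target.
\<close>

lemma null_homotopic_top_of_set:
  "null_homotopic (top_of_set S) (top_of_set T) f \<longleftrightarrow>
     (\<exists>c\<in>T. homotopic_with_canon (\<lambda>_. True) S T f (\<lambda>_. c))"
  by (simp add: null_homotopic_def)

text \<open>Stereographic projection from \<open>a\<close> identifies the punctured sphere with the
  hyperplane orthogonal to \<open>a\<close>, which is convex.\<close>

lemma contractible_punctured_sphere:
  fixes a :: "'a::euclidean_space"
  assumes "a \<in> sphere 0 1"
  shows "contractible (sphere 0 1 - {a})"
proof -
  have "a \<noteq> 0" using assms by auto
  then have "(sphere 0 1 - {a}) homeomorphic {x. a \<bullet> x = 0}"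
    using assms by (intro homeomorphic_punctured_sphere_hyperplane) auto
  then show ?thesis
    using homeomorphic_contractible_eq convex_imp_contractible affine_imp_convex
      affine_hyperplane by blast
qed

lemma null_homotopic_on_punctured_sphere:
  fixes f :: "'a::euclidean_space \<Rightarrow> 'b::euclidean_space"
  assumes "a \<in> sphere 0 1" "continuous_on (sphere 0 1) f" "f \<in> sphere 0 1 \<rightarrow> T" "T \<noteq> {}"
  shows "null_homotopic (top_of_set (sphere 0 1 - {a})) (top_of_set T) f"
proof (cases "sphere 0 1 - {a} = {}")
  case True
  show ?thesis using \<open>T \<noteq> {}\<close>
    \<comment> \<open>Over an empty domain any point of \<open>T\<close> serves as the base
      value.\<close>
    unfolding True null_homotopic_top_of_set by (auto intro: homotopic_on_emptyI)
next
  case False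
  have "continuous_on (sphere 0 1 - {a}) f"
    using assms(2) continuous_on_subset by blast
  moreover have "f \<in> (sphere 0 1 - {a}) \<rightarrow> T" using assms(3) by auto
  ultimately obtain c where
    c: "homotopic_with_canon (\<lambda>_. True) (sphere 0 1 - {a}) T f (\<lambda>_. c)"
    using nullhomotopic_from_contractible contractible_punctured_sphere[OF assms(1)] by metis
  \<comment> \<open>The homotopy ends in \<open>T\<close> at each point of the nonempty domain,
    which forces \<open>c\<close> into \<open>T\<close>.\<close>
  with False homotopic_with_imp_subset2[OF c] show ?thesis
    by (auto simp: null_homotopic_top_of_set)
qed

lemma map_cat_le_2:
  fixes f :: "'a::euclidean_space \<Rightarrow> 'b::euclidean_space"
  assumes "continuous_on (sphere 0 1) f" "f \<in> sphere 0 1 \<rightarrow> T"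
  shows "map_cat (top_of_set (sphere 0 1)) (top_of_set T) f \<le> 2"
proof -
  obtain b :: 'a where "b \<in> Basis" using nonempty_Basis by blast
  then have b: "b \<in> sphere 0 1" "- b \<in> sphere 0 1" "b \<noteq> - b"
    by (auto simp: eq_neg_iff_add_eq_0 simp flip: scaleR_2)
  \<comment> \<open>The cover has indices 1 and 2, omitting \<open>b\<close> and \<open>- b\<close>
    respectively; its union is the whole sphere because \<open>b\<close> and \<open>- b\<close>
    differ.\<close>
  define U where "U i = sphere 0 1 - {if i = (1::nat) then b else - b}" for i
  have "T \<noteq> {}" using b assms(2) by auto
  moreover have "openin (top_of_set (sphere 0 1)) (U i)" for i
    unfolding U_def by (intro openin_delete) auto
  moreover have "subtopology (top_of_set (sphere 0 1)) (U i) = top_of_set (U i)" for i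
    by (auto simp: subtopology_subtopology U_def intro: arg_cong)
  moreover have "{1..2::nat} = {1, 2}" by auto
  ultimately have "categorical_cover (top_of_set (sphere 0 1)) (top_of_set T) f 2 U"
    using null_homotopic_on_punctured_sphere[OF _ assms] b
    by (auto simp: categorical_cover_def U_def)
  then have "map_cat (top_of_set (sphere 0 1)) (top_of_set T) f \<le> enat 2"
    unfolding map_cat_def by (intro Inf_lower) force
  then show ?thesis by (simp add: numeral_eq_enat)
qed

text \<open>Covers have at least one member, so category at most 1 means that a single open set,
  necessarily the whole space, suffices.\<close>

lemma map_cat_le_1_iff: "map_cat X Y f \<le> 1 \<longleftrightarrow> null_homotopic X Y f"
proof
  let ?K = "{enat k |k. k \<ge> 1 \<and> (\<exists>U. categorical_cover X Y f k U)}"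
  assume le: "map_cat X Y f \<le> 1"
  have "?K \<noteq> {}"
  proof
    \<comment> \<open>Without any categorical cover the infimum would be \<infinity>, exceeding
      1.\<close>
    assume "?K = {}"
    then have "map_cat X Y f = Inf {}" unfolding map_cat_def by (rule arg_cong)
    with le show False by (simp add: top_enat_def)
  qed
  \<comment> \<open>\<open>enat\<close> is well-ordered, so the infimum of a nonempty set is
    attained by an actual cover.\<close>
  then have "map_cat X Y f \<in> ?K"
    unfolding map_cat_def by (meson wellorder_InfI ex_in_conv)
  then obtain k U where k: "map_cat X Y f = enat k" "k \<ge> 1" "categorical_cover X Y f k U"
    by blast
  with le have "k = 1" by (simp add: one_enat_def)
  with k have "topspace X = U 1" "null_homotopic (subtopology X (U 1)) Y f"
    by (auto simp: categorical_cover_def)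
  then show "null_homotopic X Y f" by (metis subtopology_topspace)
next
  assume "null_homotopic X Y f"
  then have "categorical_cover X Y f 1 (\<lambda>_. topspace X)"
    by (auto simp: categorical_cover_def)
  then show "map_cat X Y f \<le> 1"
    unfolding map_cat_def one_enat_def by (intro Inf_lower) blast
qed

text \<open>The ball is the cone over the sphere: a null-homotopy, read along radii with its
  constant end at the centre, is an extension avoiding 0, and conversely.\<close>

lemma null_homotopic_iff_nonvanishing_extension:
  fixes F :: "real ^ 'n \<Rightarrow> real ^ 'm"
  shows "null_homotopic (top_of_set (sphere 0 1)) (top_of_set (UNIV - {0})) F \<longleftrightarrow>
     (\<exists>\<phi>. is_extension F \<phi> \<and> (\<forall>x\<in>cball 0 1. \<phi> x \<noteq> 0))"
proof -
  have "sphere (0::real^'n) 1 \<noteq> {}" by simp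
  then have "null_homotopic (top_of_set (sphere 0 1)) (top_of_set (UNIV - {0})) F \<longleftrightarrow>
     (\<exists>c. homotopic_with_canon (\<lambda>_. True) (sphere 0 1) (UNIV - {0}) F (\<lambda>_. c))"
    unfolding null_homotopic_top_of_set
    using homotopic_with_imp_subset2 by fastforce
  then show ?thesis
    unfolding nullhomotopic_from_sphere_extension is_extension_def by (simp add: image_subset_iff) blast
qed

theorem mainTheorem1:
  fixes F :: "real ^ 'n \<Rightarrow> real ^ 'm"
  assumes "continuous_on (cball 0 1) F"
    and "\<And>x. x \<in> sphere 0 1 \<Longrightarrow> F x \<noteq> 0"
  shows "(\<forall>\<phi>. is_extension F \<phi> \<longrightarrow> (\<exists>x\<in>cball 0 1. \<phi> x = 0)) \<longleftrightarrow>
         map_cat (top_of_set (sphere 0 1)) (top_of_set (UNIV - {0})) F = 2"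
proof -
  let ?c = "map_cat (top_of_set (sphere 0 1)) (top_of_set (UNIV - {0})) F"
  have "continuous_on (sphere 0 1) F"
    using assms(1) continuous_on_subset sphere_cball by blast
  then have "?c \<le> 2" using assms(2) by (intro map_cat_le_2) auto
  \<comment> \<open>No element of \<open>enat\<close> lies strictly between 1 and 2.\<close>
  then have "?c = 2 \<longleftrightarrow> \<not> ?c \<le> 1"
    by (cases ?c) (auto simp: one_enat_def numeral_eq_enat)
  then show ?thesis
    unfolding map_cat_le_1_iff null_homotopic_iff_nonvanishing_extension by blast
qed

end
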